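(* Suppose that $\mathcal E_\beta=\{x\}$ for some $\beta\in\mathbb R^\sigma$ (and some $x\in\mathcal X$). Then $\mathcal E^{\tilde u}=\{x\}$, where $\tilde u:=\tilde H(x)$.
   Context: Setting. For each $n\in\mathbb N$, $(\Omega_n,\mathcal F_n,P_n)$ is a probability space; $\sigma\ge1$ is an integer; $H_{n,1},\dots,H_{n,\sigma}:\Omega_n\to\mathbb R$ are bounded measurable functions; $a_n>0$ with $a_n\to\infty$. $\mathcal X$ is a Polish space, $Y_n:\Omega_n\to\mathcal X$ are random variables, and $\tilde H_1,\dots,\tilde H_\sigma:\mathcal X\to\mathbb R$ are bounded continuous functions such that $\lim_{n\to\infty}\sup_{\omega\in\Omega_n}|H_{n,i}(\omega)-\tilde H_i(Y_n(\omega))|=0$ for each $i$; $\tilde H:=(\tilde H_1,\dots,\tilde H_\sigma)$. With respect to $P_n$, $Y_n$ satisfies the large deviation principle on $\mathcal X$ with scaling constants $a_n$ and rate function $I:\mathcal X\to[0,\infty]$, where rate functions have compact level sets $\{I\le M\}$, $0\le M<\infty$ (in particular $\inf_{\mathcal X}I=0$). $\langle\cdot,\cdot\rangle$ is the Euclidean inner product. Definitions. $s(u):=-\inf\{I(x):x\in\mathcal X,\ \tilde H(x)=u\}\in[-\infty,0]$ for $u\in\mathbb R^\sigma$ (with $\inf\emptyset=\infty$); $\operatorname{dom}s:=\{u: s(u)>-\infty\}$. Canonical equilibrium macrostates: $\mathcal E_\beta:=\{x\in\mathcal X: I(x)+\langle\beta,\tilde H(x)\rangle=\inf_{y\in\mathcal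 X}\{I(y)+\langle\beta,\tilde H(y)\rangle\}\}$. Microcanonical equilibrium macrostates: $\mathcal E^u:=\{x\in\mathcal X:\tilde H(x)=u,\ I(x)=-s(u)\}$ for $u\in\operatorname{dom}s$, and $\mathcal E^u:=\emptyset$ for $u\notin\operatorname{dom}s$. *)

theory Defs
  imports "HOL-Probability.Probability"
begin

definition rate_function :: "('x::topological_space \<Rightarrow> ereal) \<Rightarrow> bool" where
  "rate_function I \<longleftrightarrow>
     (\<forall>x. 0 \<le> I x) \<and> (\<forall>c::real. 0 \<le> c \<longrightarrow> compact {x. I x \<le> ereal c})"

(* The library has ln 0 = 0; large deviations need log 0 = -infinity. *)
definition ext_ln :: "real \<Rightarrow> ereal" where
  "ext_ln p = (if p = 0 then -\<infinity> else ereal (ln p))"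

definition large_deviation_principle ::
  "(nat \<Rightarrow> 'w measure) \<Rightarrow> (nat \<Rightarrow> 'w \<Rightarrow> 'x::topological_space) \<Rightarrow> (nat \<Rightarrow> real)
     \<Rightarrow> ('x \<Rightarrow> ereal) \<Rightarrow> bool" where
  "large_deviation_principle P Y a I \<longleftrightarrow>
     rate_function I \<and>
     (\<forall>F. closed F \<longrightarrow>
        limsup (\<lambda>n. ereal (1 / a n) * ext_ln (measure (P n) (Y n -` F \<inter> space (P n))))
          \<le> - (INF x\<in>F. I x)) \<and>
     (\<forall>G. open G \<longrightarrow>
        - (INF x\<in>G. I x)
          \<le> liminf (\<lambda>n. ereal (1 / a n) * ext_ln (measure (P n) (Y n -` G \<inter> space (P n)))))"

definition micro_entropy :: "('x \<Rightarrow> ereal) \<Rightarrow> ('x \<Rightarrow> 'v) \<Rightarrow> 'v \<Rightarrow> ereal" where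
  "micro_entropy I Ht u = - (INF x\<in>{x. Ht x = u}. I x)"

definition entropy_dom :: "('x \<Rightarrow> ereal) \<Rightarrow> ('x \<Rightarrow> 'v) \<Rightarrow> 'v set" where
  "entropy_dom I Ht = {u. micro_entropy I Ht u > -\<infinity>}"

definition canonical_macrostates ::
  "('x \<Rightarrow> ereal) \<Rightarrow> ('x \<Rightarrow> 'v::real_inner) \<Rightarrow> 'v \<Rightarrow> 'x set" where
  "canonical_macrostates I Ht \<beta> =
     {x. I x + ereal (\<beta> \<bullet> Ht x) = (INF y. I y + ereal (\<beta> \<bullet> Ht y))}"

definition microcanonical_macrostates ::
  "('x \<Rightarrow> ereal) \<Rightarrow> ('x \<Rightarrow> 'v) \<Rightarrow> 'v \<Rightarrow> 'x set" where
  "microcanonical_macrostates I Ht u =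
     (if u \<in> entropy_dom I Ht then {x. Ht x = u \<and> I x = - micro_entropy I Ht u} else {})"

end

theory Submission
  imports Defs
begin

text \<open>
  On the fibre \<open>{y. Ht y = Ht x}\<close> the tilt \<open>\<beta> \<bullet> Ht y\<close> is a real constant, so there the tilted
  functional \<open>I y + \<beta> \<bullet> Ht y\<close> and the rate function \<open>I\<close> have the same minimizers. A global minimizer
  \<open>x\<close> of the tilted functional therefore minimizes \<open>I\<close> over its own fibre; conversely, a point of that
  fibre with the same value of \<open>I\<close> attains the global tilted minimum, and so equals \<open>x\<close> when the
  canonical macrostate is unique.

  The microcanonical set is nonempty only for energies in the domain of the entropy, so
  \<open>I x < \<infinity>\<close> is needed as well. This is where probability enters: the whole space has
  probability one, hence the large deviation upper bound forces \<open>inf I = 0\<close>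
  (\<open>rate_inf_eq_0\<close>), so \<open>I\<close> is finite somewhere, and then a minimizer of the tilted functional
  cannot have infinite rate (\<open>canonical_macrostate_finite_rate\<close>).
\<close>

text \<open>
  The logarithmic probability of the whole space vanishes, so the upper bound for the closed set
  \<open>UNIV\<close> reads \<open>0 \<le> - inf I\<close>.
\<close>
lemma rate_inf_eq_0:
  assumes prob: "\<And>n. prob_space (P n)"
    and LDP: "large_deviation_principle P Y a I"
  shows "(INF y. I y) = 0"
proof (rule antisym)
  have "measure (P n) (Y n -` UNIV \<inter> space (P n)) = 1" for n
    using prob_space.prob_space[OF prob[of n]] by simp
  then have "(\<lambda>n. ereal (1 / a n) * ext_ln (measure (P n) (Y n -` UNIV \<inter> space (P n)))) = (\<lambda>n. 0)"
    by (simp add: ext_ln_def zero_ereal_def)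
  moreover have "limsup (\<lambda>n. ereal (1 / a n) * ext_ln (measure (P n) (Y n -` UNIV \<inter> space (P n))))
      \<le> - (INF y\<in>UNIV. I y)"
    using LDP unfolding large_deviation_principle_def by blast
  ultimately have "0 \<le> - (INF y. I y)"
    by (simp add: Limsup_const)
  then show "(INF y. I y) \<le> 0"
    by (simp add: ereal_0_le_uminus_iff)
next
  show "0 \<le> (INF y. I y)"
    using LDP by (auto simp: large_deviation_principle_def rate_function_def intro: INF_greatest)
qed

lemma canonical_macrostate_le:
  assumes "x \<in> canonical_macrostates I Ht \<beta>"
  shows "I x + ereal (\<beta> \<bullet> Ht x) \<le> I y + ereal (\<beta> \<bullet> Ht y)"
proof -
  have "I x + ereal (\<beta> \<bullet> Ht x) = (INF y. I y + ereal (\<beta> \<bullet> Ht y))"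
    using assms by (simp add: canonical_macrostates_def)
  also have "\<dots> \<le> I y + ereal (\<beta> \<bullet> Ht y)"
    by (rule INF_lower) simp
  finally show ?thesis .
qed

text \<open>
  The tilt is finite, so a minimizer of infinite rate would make \<open>I\<close> identically infinite.
\<close>
lemma canonical_macrostate_finite_rate:
  assumes "x \<in> canonical_macrostates I Ht \<beta>" and "(INF y. I y) \<noteq> \<infinity>"
  shows "I x \<noteq> \<infinity>"
proof
  assume "I x = \<infinity>"
  then have "I y = \<infinity>" for y
    using canonical_macrostate_le[OF assms(1), of y] by (cases "I y") auto
  then show False
    using assms(2) by simp
qed

lemma canonical_macrostate_minimizes_rate_on_fibre:
  assumes "x \<in> canonical_macrostates I Ht \<beta>" and "Ht y = Ht x"
  shows "I x \<le> I y"
  using canonical_macrostate_le[OF assms(1), of y] assms(2)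
  by (cases "I x"; cases "I y") auto

lemma micro_entropy_canonical_macrostate:
  assumes "x \<in> canonical_macrostates I Ht \<beta>"
  shows "micro_entropy I Ht (Ht x) = - I x"
proof -
  have "(INF y\<in>{y. Ht y = Ht x}. I y) = I x"
    by (intro antisym INF_lower INF_greatest)
      (auto intro: canonical_macrostate_minimizes_rate_on_fibre[OF assms])
  then show ?thesis
    by (simp add: micro_entropy_def)
qed

text \<open>
  Two points of the fibre of \<open>x\<close> have the same tilt, so equal rates mean equal tilted values: the
  points that share the minimal rate of \<open>x\<close> on the fibre are those that share its global tilted
  minimum. Finiteness of \<open>I x\<close> puts \<open>Ht x\<close> in the domain of the entropy.
\<close>
lemma microcanonical_eq_canonical_on_fibre:
  assumes x: "x \<in> canonical_macrostates I Ht \<beta>" and fin: "I x \<noteq> \<infinity>"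
  shows "microcanonical_macrostates I Ht (Ht x) = {y \<in> canonical_macrostates I Ht \<beta>. Ht y = Ht x}"
proof -
  have s: "micro_entropy I Ht (Ht x) = - I x"
    by (rule micro_entropy_canonical_macrostate[OF x])
  then have "Ht x \<in> entropy_dom I Ht"
    using fin by (cases "I x") (auto simp: entropy_dom_def)
  then have "microcanonical_macrostates I Ht (Ht x) = {y. Ht y = Ht x \<and> I y = I x}"
    using s by (simp add: microcanonical_macrostates_def)
  also have "\<dots> = {y \<in> canonical_macrostates I Ht \<beta>. Ht y = Ht x}"
  proof -
    have "I y = I x" if "y \<in> canonical_macrostates I Ht \<beta>" "Ht y = Ht x" for y
      using canonical_macrostate_minimizes_rate_on_fibre[OF x that(2)]
        canonical_macrostate_minimizes_rate_on_fibre[OF that(1) that(2)[symmetric]]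
      by (rule antisym[rotated])
    moreover have "y \<in> canonical_macrostates I Ht \<beta>" if "Ht y = Ht x" "I y = I x" for y
      using x that by (simp add: canonical_macrostates_def)
    ultimately show ?thesis by blast
  qed
  finally show ?thesis .
qed

theorem corollary4p7:
  fixes P :: "nat \<Rightarrow> 'w measure"
    and H :: "nat \<Rightarrow> 'w \<Rightarrow> real ^ 's"
    and a :: "nat \<Rightarrow> real"
    and Y :: "nat \<Rightarrow> 'w \<Rightarrow> 'x::polish_space"
    and Ht :: "'x \<Rightarrow> real ^ 's"
    and I :: "'x \<Rightarrow> ereal"
    and \<beta> :: "real ^ 's"
    and x :: 'x
  assumes prob: "\<And>n. prob_space (P n)"
    and H_measurable: "\<And>n i. (\<lambda>\<omega>. H n \<omega> $ i) \<in> borel_measurable (P n)"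
    and H_bounded: "\<And>n i. bounded ((\<lambda>\<omega>. H n \<omega> $ i) ` space (P n))"
    and a_pos: "\<And>n. a n > 0"
    and a_lim: "filterlim a at_top sequentially"
    and Y_measurable: "\<And>n. Y n \<in> measurable (P n) borel"
    and Ht_continuous: "\<And>i. continuous_on UNIV (\<lambda>y. Ht y $ i)"
    and Ht_bounded: "\<And>i. bounded (range (\<lambda>y. Ht y $ i))"
    and approx: "\<And>i. (\<lambda>n. SUP \<omega>\<in>space (P n). \<bar>H n \<omega> $ i - Ht (Y n \<omega>) $ i\<bar>) \<longlonglongrightarrow> 0"
    and LDP: "large_deviation_principle P Y a I"
    and unique: "canonical_macrostates I Ht \<beta> = {x}"
  shows "microcanonical_macrostates I Ht (Ht x) = {x}"
proof -
  have x: "x \<in> canonical_macrostates I Ht \<beta>"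
    using unique by simp
  have "I x \<noteq> \<infinity>"
    using canonical_macrostate_finite_rate[OF x] rate_inf_eq_0[OF prob LDP] by simp
  then show ?thesis
    using microcanonical_eq_canonical_on_fibre[OF x] unique by auto
qed

end
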